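(* Let $\alpha,\beta\in\mathbb{R}$, let $F:\mathbb{R}\to\mathbb{R}$ be defined by $F(x)=\alpha x+\beta$ for $x\in\mathbb{R}$, and let $C:=[-1,1]$. Then $F$ is strongly pseudomonotone on $C$ if and only if $(\alpha,\beta)$ belongs to the cone $$\mathcal{A}:=\big\{(\alpha,\beta)\in\mathbb{R}^2 \mid \alpha+\beta>0\ \text{ or }\ \alpha-\beta>0\big\}.$$
   Context: An operator $F$ is strongly pseudomonotone on a convex set $C\subset\mathbb{R}^n$ if there exists a constant $\gamma>0$ such that for all $x,y\in C$: $$\langle F(x),y-x\rangle\ge 0\ \Longrightarrow\ \langle F(y),y-x\rangle\ge\gamma\|y-x\|^2.$$ Here $n=1$ and $\langle a,b\rangle=ab$. *)

theory Defs
  imports "HOL-Analysis.Analysis"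
begin

text \<open>
  Convexity of \<open>C\<close> is a standing assumption on the domain and not a clause of the
  property, so it is not part of the definition. On type \<open>real\<close>, the case n = 1, the inner
  product is multiplication.
\<close>

definition strongly_pseudomonotone_on ::
    "'a::euclidean_space set \<Rightarrow> ('a \<Rightarrow> 'a) \<Rightarrow> bool"
  where
    "strongly_pseudomonotone_on C F \<longleftrightarrow>
      (\<exists>\<gamma>>0. \<forall>x\<in>C. \<forall>y\<in>C.
         F x \<bullet> (y - x) \<ge> 0 \<longrightarrow> F y \<bullet> (y - x) \<ge> \<gamma> * (norm (y - x))\<^sup>2)"

end

theory Submission
  imports Defs
begin

text \<open>
  The condition on \<open>(\<alpha>, \<beta>)\<close> says that \<open>F 1 > 0\<close> or \<open>F (-1) < 0\<close>. If both fail, the pair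
  \<open>x = -1\<close>, \<open>y = 1\<close> violates strong pseudomonotonicity. Conversely, if \<open>\<alpha> > 0\<close> then \<open>F\<close> is
  strongly monotone with modulus \<open>\<alpha>\<close>; if \<open>\<alpha> \<le> 0\<close> then \<open>F\<close> has constant sign and is bounded
  away from 0 on \<open>[-1, 1]\<close>, and \<open>\<bar>y - x\<bar> \<ge> (y - x)\<^sup>2 / 2\<close> there.
\<close>

lemma strongly_pseudomonotone_on_real_iff:
  fixes F :: "real \<Rightarrow> real"
  shows "strongly_pseudomonotone_on C F \<longleftrightarrow>
    (\<exists>\<gamma>>0. \<forall>x\<in>C. \<forall>y\<in>C. F x * (y - x) \<ge> 0 \<longrightarrow> F y * (y - x) \<ge> \<gamma> * (y - x)\<^sup>2)"
  by (simp add: strongly_pseudomonotone_on_def)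

text \<open>Reflection flips the signs of both \<open>F\<close> and \<open>y - x\<close>, so the
  products in the definition are unchanged. This reduces the case
  \<open>\<alpha> - \<beta> > 0\<close> to \<open>\<alpha> + \<beta> > 0\<close>.\<close>

lemma strongly_pseudomonotone_on_uminus_iff:
  fixes F :: "real \<Rightarrow> real"
  shows "strongly_pseudomonotone_on (uminus ` C) (\<lambda>x. - F (- x)) \<longleftrightarrow>
    strongly_pseudomonotone_on C F"
proof -
  have "- a * (- y - - x) = a * (y - x)" "(- y - - x)\<^sup>2 = (y - x)\<^sup>2" for a x y :: real
    by (simp_all add: algebra_simps power2_eq_square)
  then show ?thesis
    unfolding strongly_pseudomonotone_on_real_iff by simp
qed

lemma strongly_pseudomonotone_on_affine_increasing:
  fixes \<alpha> \<beta> :: real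
  assumes "\<alpha> > 0"
  shows "strongly_pseudomonotone_on C (\<lambda>x. \<alpha> * x + \<beta>)"
proof -
  have "(\<alpha> * y + \<beta>) * (y - x) = (\<alpha> * x + \<beta>) * (y - x) + \<alpha> * (y - x)\<^sup>2" for x y
    by (simp add: algebra_simps power2_eq_square)
  then show ?thesis
    unfolding strongly_pseudomonotone_on_real_iff using assms by (intro exI[of _ \<alpha>]) simp
qed

text \<open>Positivity of \<open>F\<close> turns the premise into \<open>x \<le> y\<close>; then the
  linear bound \<open>m * (y - x)\<close> dominates a quadratic one with modulus
  \<open>m / 2\<close>, because the interval has length 2.\<close>

lemma strongly_pseudomonotone_on_bounded_below:
  fixes F :: "real \<Rightarrow> real"
  assumes "m > 0" and m: "\<And>x. x \<in> {-1..1} \<Longrightarrow> F x \<ge> m"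
  shows "strongly_pseudomonotone_on {-1..1} F"
proof -
  have "F y * (y - x) \<ge> m / 2 * (y - x)\<^sup>2"
    if x: "x \<in> {-1..1}" and y: "y \<in> {-1..1}" and xy: "F x * (y - x) \<ge> 0" for x y
  proof -
    have "F x > 0" using m[OF x] \<open>m > 0\<close> by linarith
    with xy have nonneg: "y - x \<ge> 0" by (simp add: zero_le_mult_iff)
    have "m / 2 * (y - x)\<^sup>2 = m * (y - x) * ((y - x) / 2)"
      by (simp add: power2_eq_square)
    also have "\<dots> \<le> m * (y - x) * 1"
      using x y nonneg \<open>m > 0\<close> by (intro mult_left_mono) auto
    also have "\<dots> \<le> F y * (y - x)"
      using m[OF y] nonneg by (simp add: mult_right_mono)
    finally show ?thesis .
  qed
  then show ?thesis
    unfolding strongly_pseudomonotone_on_real_iff using \<open>m > 0\<close> by (intro exI[of _ "m / 2"]) auto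
qed

lemma strongly_pseudomonotone_on_affine:
  fixes \<alpha> \<beta> :: real
  assumes "\<alpha> + \<beta> > 0"
  shows "strongly_pseudomonotone_on {-1..1} (\<lambda>x. \<alpha> * x + \<beta>)"
proof (cases "\<alpha> > 0")
  case True
  then show ?thesis by (rule strongly_pseudomonotone_on_affine_increasing)
next
  case False
  \<comment> \<open>A nonincreasing \<open>F\<close> attains its minimum at the right endpoint 1, so
    \<open>\<alpha> + \<beta>\<close> serves as \<open>m\<close>.\<close>
  then have "\<alpha> * x + \<beta> \<ge> \<alpha> + \<beta>" if "x \<in> {-1..1}" for x
    using that mult_left_mono_neg[of x 1 \<alpha>] by simp
  with assms show ?thesis by (rule strongly_pseudomonotone_on_bounded_below)
qed

theorem theorem3p1:
  fixes \<alpha> \<beta> :: real and F :: "real \<Rightarrow> real" and C :: "real set" and A :: "(real \<times> real) set"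
  assumes F: "\<And>x. F x = \<alpha> * x + \<beta>"
    and C: "C = {-1..1}"
    and A: "A = {(a, b). a + b > 0 \<or> a - b > 0}"
  shows "strongly_pseudomonotone_on C F \<longleftrightarrow> (\<alpha>, \<beta>) \<in> A"
proof
  assume "strongly_pseudomonotone_on C F"
  then obtain \<gamma> where "\<gamma> > 0"
    and \<gamma>: "\<And>x y. x \<in> C \<Longrightarrow> y \<in> C \<Longrightarrow> F x * (y - x) \<ge> 0 \<Longrightarrow> F y * (y - x) \<ge> \<gamma> * (y - x)\<^sup>2"
    unfolding strongly_pseudomonotone_on_real_iff by blast
  \<comment> \<open>Outside \<open>A\<close>, \<open>F (-1) \<ge> 0\<close> makes the premise true
    for this pair, so \<open>2 * F 1 \<ge> 4 * \<gamma> > 0\<close>, against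
    \<open>\<alpha> + \<beta> \<le> 0\<close>.\<close>
  show "(\<alpha>, \<beta>) \<in> A"
    using \<gamma>[of "-1" 1] \<open>\<gamma> > 0\<close> by (auto simp: F C A)
next
  have F_eq: "F = (\<lambda>x. \<alpha> * x + \<beta>)" by (rule ext) (rule F)
  assume "(\<alpha>, \<beta>) \<in> A"
  then consider "\<alpha> + \<beta> > 0" | "\<alpha> + - \<beta> > 0" by (auto simp: A)
  then show "strongly_pseudomonotone_on C F"
  proof cases
    case 1
    then show ?thesis unfolding C F_eq by (rule strongly_pseudomonotone_on_affine)
  next
    case 2
    then have "strongly_pseudomonotone_on {-1..1} (\<lambda>x. \<alpha> * x + - \<beta>)"
      by (rule strongly_pseudomonotone_on_affine)
    \<comment> \<open>\<open>C\<close> is symmetric about 0, and \<open>- F (- x)\<close> is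
      \<open>\<alpha> * x - \<beta>\<close>.\<close>
    then show ?thesis
      using strongly_pseudomonotone_on_uminus_iff[of C F] by (simp add: C F)
  qed
qed

end
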